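(* Let $X$ be a $d$-dimensional simplicial complex and $\beta>0$ such that for every nonempty face $\sigma\in X$ of dimension at most $d-2$, the link $X_\sigma$ is a $\beta$-coboundary expander. Let $0\le\ell<k<d$ and let $f\in Z^k(X)$ be a minimal $k$-cocycle, i.e. $\delta f=\mathbf{0}$ and $\|f\|\le\|f+g\|$ for every $g\in B^k(X)$. Then $f$ is $\frac{\ell+1}{\beta}$-double balanced in dimension $\ell$, i.e. for every $\sigma\in X(\ell)$, $$\|f_\sigma\| \le \frac{\ell+1}{\beta}\,\mathbb{E}_{u\in\sigma}\|(f_{\sigma\setminus u})^u\|.$$
   Context: A $d$-dimensional simplicial complex $X$ is a finite downward-closed family of finite sets (faces) whose maximal faces have size $d+1$; $X(j)$ is the set of $j$-faces (size $j+1$), with $X(-1)=\{\emptyset\}$. Standing assumption: $P_d$ on $X(d)$ is uniform; for $j<d$, $P_j$ on $X(j)$ is obtained by drawing $\sigma\sim P_d$ and then a uniformly random $j$-subface. The link of $\sigma$ is $X_\sigma=\{\tau\setminus\sigma:\sigma\subseteq\tau\in X\}$, with the induced (conditional) distributions on its faces. $C^j(X)$ is the $\mathbb{F}_2$-space of functions $X(j)\to\mathbb{F}_2$, and $\|f\|=\Pr_{\sigma\sim P_j}[f(\sigma)\ne0]$, $\mathrm{dist}(f,g)=\|f-g\|$ (on links, computed with link distributions). The coboundary $\delta:C^j(X)\to C^{j+1}(X)$ is $\delta f(\sigma)=\sum_{v\in\sigma}f(\sigma\setminus\{v\})$ mod 2 (with the convention that $C^{-1}$ consists of functions on $\{\emptyset\}$,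 so $B^0$ is the set of constant functions). $Z^j=\ker\delta$, $B^j=\operatorname{im}\delta$. A complex $Y$ of dimension $m$ is a $\beta$-coboundary expander if for every $j<m$ and every $g\in C^j(Y)\setminus B^j(Y)$, $\|\delta g\|\ge\beta\,\mathrm{dist}(g,B^j(Y))$. For $f\in C^k(X)$, $\sigma\in X(\ell)$, $\ell<k$: localization $f_\sigma\in C^{k-\ell-1}(X_\sigma)$, $f_\sigma(\tau)=f(\sigma\cup\tau)$; restriction $f^\sigma\in C^k(X_\sigma)$, $f^\sigma(\tau)=f(\tau)$; $f_\emptyset=f$. In the claim, $u$ is uniform over the vertices of $\sigma$, and $(f_{\sigma\setminus u})^u\in C^{k-\ell}(X_\sigma)$ is the restriction of $f_{\sigma\setminus u}$ (a cochain on $X_{\sigma\setminus u}$) to the link of $u$ in $X_{\sigma\setminus u}$, namely $X_\sigma$; norms of $f_\sigma$ and $(f_{\sigma\setminus u})^u$ are in $X_\sigma$. *)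

theory Defs
  imports "HOL-Probability.Probability" "HOL-Library.Z2" "HOL-Library.Function_Algebras"
begin

text \<open>
  Dimensions are integers, since dimension \<open>-1\<close> (the empty face) occurs: the \<open>j\<close>-faces are the
  faces with \<open>j + 1\<close> vertices. The field with two elements is the library type \<open>bit\<close>.
\<close>

definition pure_simplicial_complex :: "int \<Rightarrow> 'a set set \<Rightarrow> bool" where
  "pure_simplicial_complex d X \<longleftrightarrow>
     finite X \<and> {} \<in> X \<and> (\<forall>\<sigma>\<in>X. finite \<sigma>) \<and> (\<forall>\<sigma>\<in>X. \<forall>\<tau>. \<tau> \<subseteq> \<sigma> \<longrightarrow> \<tau> \<in> X) \<and>
     (\<forall>\<sigma>\<in>X. (\<forall>\<tau>\<in>X. \<sigma> \<subseteq> \<tau> \<longrightarrow> \<tau> = \<sigma>) \<longrightarrow> int (card \<sigma>) = d + 1)"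

definition faces :: "'a set set \<Rightarrow> int \<Rightarrow> 'a set set" where
  "faces X j = {\<sigma> \<in> X. int (card \<sigma>) = j + 1}"

definition cdim :: "'a set set \<Rightarrow> int" where
  "cdim X = Max ((\<lambda>\<sigma>. int (card \<sigma>) - 1) ` X)"

definition link :: "'a set set \<Rightarrow> 'a set \<Rightarrow> 'a set set" where
  "link X \<sigma> = {\<tau> - \<sigma> | \<tau>. \<sigma> \<subseteq> \<tau> \<and> \<tau> \<in> X}"

text \<open>
  The distribution on \<open>j\<close>-faces. For a link, it agrees with the conditional distribution induced
  by the ambient complex; see \<open>face_pmf_link\<close> below.
\<close>

definition face_pmf :: "'a set set \<Rightarrow> int \<Rightarrow> 'a set pmf" where
  "face_pmf X j =
     bind_pmf (pmf_of_set (faces X (cdim X)))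
       (\<lambda>\<sigma>. pmf_of_set {\<tau>. \<tau> \<subseteq> \<sigma> \<and> int (card \<tau>) = j + 1})"

text \<open>
  A cochain is a total function on vertex sets that vanishes off the \<open>j\<close>-faces, so that equality of
  cochains is equality of functions.
\<close>

definition cochains :: "'a set set \<Rightarrow> int \<Rightarrow> ('a set \<Rightarrow> bit) set" where
  "cochains X j = {f. \<forall>\<sigma>. \<sigma> \<notin> faces X j \<longrightarrow> f \<sigma> = 0}"

definition cnorm :: "'a set set \<Rightarrow> int \<Rightarrow> ('a set \<Rightarrow> bit) \<Rightarrow> real" where
  "cnorm X j f = measure_pmf.prob (face_pmf X j) {\<sigma>. f \<sigma> \<noteq> 0}"

definition cdist_set :: "'a set set \<Rightarrow> int \<Rightarrow> ('a set \<Rightarrow> bit) \<Rightarrow> ('a set \<Rightarrow> bit) set \<Rightarrow> real" where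
  "cdist_set X j g B = (INF h\<in>B. cnorm X j (g - h))"

definition coboundary :: "'a set set \<Rightarrow> int \<Rightarrow> ('a set \<Rightarrow> bit) \<Rightarrow> ('a set \<Rightarrow> bit)" where
  "coboundary X j f = (\<lambda>\<sigma>. if \<sigma> \<in> faces X (j + 1) then \<Sum>v\<in>\<sigma>. f (\<sigma> - {v}) else 0)"

definition cocycles :: "'a set set \<Rightarrow> int \<Rightarrow> ('a set \<Rightarrow> bit) set" where
  "cocycles X j = {f \<in> cochains X j. coboundary X j f = 0}"

definition coboundaries :: "'a set set \<Rightarrow> int \<Rightarrow> ('a set \<Rightarrow> bit) set" where
  "coboundaries X j = coboundary X (j - 1) ` cochains X (j - 1)"

definition coboundary_expander :: "real \<Rightarrow> 'a set set \<Rightarrow> bool" where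
  "coboundary_expander \<beta> Y \<longleftrightarrow>
     (\<forall>j. 0 \<le> j \<and> j < cdim Y \<longrightarrow>
       (\<forall>g \<in> cochains Y j - coboundaries Y j.
          cnorm Y (j + 1) (coboundary Y j g) \<ge> \<beta> * cdist_set Y j g (coboundaries Y j)))"

definition minimal_cocycle :: "'a set set \<Rightarrow> int \<Rightarrow> ('a set \<Rightarrow> bit) \<Rightarrow> bool" where
  "minimal_cocycle X k f \<longleftrightarrow>
     f \<in> cocycles X k \<and> (\<forall>g \<in> coboundaries X k. cnorm X k f \<le> cnorm X k (f + g))"

text \<open>
  Localization at and restriction to the link of \<open>\<sigma>\<close>, for \<open>f\<close> a \<open>k\<close>-cochain on \<open>X\<close>; if \<open>\<sigma>\<close> has
  dimension \<open>l\<close>, then \<open>k - int (card \<sigma>) = k - l - 1\<close>.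
\<close>

definition localization ::
  "'a set set \<Rightarrow> int \<Rightarrow> ('a set \<Rightarrow> bit) \<Rightarrow> 'a set \<Rightarrow> ('a set \<Rightarrow> bit)" where
  "localization X k f \<sigma> =
     (\<lambda>\<tau>. if \<tau> \<in> faces (link X \<sigma>) (k - int (card \<sigma>)) then f (\<sigma> \<union> \<tau>) else 0)"

definition restriction ::
  "'a set set \<Rightarrow> int \<Rightarrow> ('a set \<Rightarrow> bit) \<Rightarrow> 'a set \<Rightarrow> ('a set \<Rightarrow> bit)" where
  "restriction X k f \<sigma> = (\<lambda>\<tau>. if \<tau> \<in> faces (link X \<sigma>) k then f \<tau> else 0)"

definition double_balanced ::
  "real \<Rightarrow> int \<Rightarrow> 'a set set \<Rightarrow> int \<Rightarrow> ('a set \<Rightarrow> bit) \<Rightarrow> bool" where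
  "double_balanced \<alpha> l X k f \<longleftrightarrow>
     (\<forall>\<sigma> \<in> faces X l.
        cnorm (link X \<sigma>) (k - l - 1) (localization X k f \<sigma>)
          \<le> \<alpha> * measure_pmf.expectation (pmf_of_set \<sigma>)
                 (\<lambda>u. cnorm (link X \<sigma>) (k - l)
                        (restriction (link X (\<sigma> - {u})) (k - l)
                           (localization X k f (\<sigma> - {u})) {u})))"



lemma top_above:
  assumes X: "pure_simplicial_complex d X" and s: "\<sigma> \<in> X"
  obtains \<rho> where "\<rho> \<in> faces X d" "\<sigma> \<subseteq> \<rho>"
proof -
  have fin: "finite {\<tau> \<in> X. \<sigma> \<subseteq> \<tau>}" using X by (simp add: pure_simplicial_complex_def)
  have "\<sigma> \<in> {\<tau> \<in> X. \<sigma> \<subseteq> \<tau>}" using s by simp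
  from finite_has_maximal2[OF fin this] obtain \<rho>
    where r: "\<rho> \<in> {\<tau> \<in> X. \<sigma> \<subseteq> \<tau>}"
      "\<forall>b \<in> {\<tau> \<in> X. \<sigma> \<subseteq> \<tau>}. \<rho> \<subseteq> b \<longrightarrow> \<rho> = b" by (elim bexE conjE)
  have m: "\<rho> \<in> X" "\<sigma> \<subseteq> \<rho>" using r(1) by simp_all
  have "\<forall>\<tau>\<in>X. \<rho> \<subseteq> \<tau> \<longrightarrow> \<tau> = \<rho>"
  proof (intro ballI impI)
    fix \<tau> assume "\<tau> \<in> X" "\<rho> \<subseteq> \<tau>"
    with m r(2) show "\<tau> = \<rho>" by auto
  qed
  with m X have "int (card \<rho>) = d + 1" unfolding pure_simplicial_complex_def by blast
  with m have "\<rho> \<in> faces X d" by (simp add: faces_def)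
  from this m(2) show ?thesis by (rule that)
qed

lemma cdim_eq:
  assumes X: "pure_simplicial_complex d X"
  shows "cdim X = d"
  unfolding cdim_def
proof (rule Max_eqI)
  show "finite ((\<lambda>\<sigma>. int (card \<sigma>) - 1) ` X)" using X by (simp add: pure_simplicial_complex_def)
  show "y \<le> d" if "y \<in> (\<lambda>\<sigma>. int (card \<sigma>) - 1) ` X" for y
  proof -
    from that obtain \<sigma> where s: "\<sigma> \<in> X" "y = int (card \<sigma>) - 1" by auto
    from top_above[OF X s(1)] obtain \<rho> where r: "\<rho> \<in> faces X d" "\<sigma> \<subseteq> \<rho>" .
    with X have "card \<sigma> \<le> card \<rho>"
      by (intro card_mono) (auto simp: pure_simplicial_complex_def faces_def)
    with r s show ?thesis by (simp add: faces_def)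
  qed
  have "{} \<in> X" using X by (simp add: pure_simplicial_complex_def)
  from top_above[OF X this] obtain \<rho> where "\<rho> \<in> faces X d" .
  then show "d \<in> (\<lambda>\<sigma>. int (card \<sigma>) - 1) ` X"
    by (intro image_eqI[of _ _ \<rho>]) (auto simp: faces_def)
qed

lemma in_link_iff:
  assumes X: "pure_simplicial_complex d X"
  shows "\<tau> \<in> link X \<sigma> \<longleftrightarrow> \<tau> \<inter> \<sigma> = {} \<and> \<sigma> \<union> \<tau> \<in> X"
proof
  assume "\<tau> \<in> link X \<sigma>"
  then obtain \<rho> where "\<tau> = \<rho> - \<sigma>" "\<sigma> \<subseteq> \<rho>" "\<rho> \<in> X" by (auto simp: link_def)
  moreover from this have "\<sigma> \<union> \<tau> = \<rho>" by blast
  ultimately show "\<tau> \<inter> \<sigma> = {} \<and> \<sigma> \<union> \<tau> \<in> X" by auto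
next
  assume a: "\<tau> \<inter> \<sigma> = {} \<and> \<sigma> \<union> \<tau> \<in> X"
  then have "\<tau> = (\<sigma> \<union> \<tau>) - \<sigma>" by blast
  with a show "\<tau> \<in> link X \<sigma>" unfolding link_def by blast
qed

lemma pure_simplicial_complex_link:
  assumes X: "pure_simplicial_complex d X" and s: "\<sigma> \<in> X"
  shows "pure_simplicial_complex (d - int (card \<sigma>)) (link X \<sigma>)"
  unfolding pure_simplicial_complex_def
proof (intro conjI ballI allI impI)
  have fs: "finite \<sigma>" using X s by (simp add: pure_simplicial_complex_def)
  have "link X \<sigma> = (\<lambda>\<tau>. \<tau> - \<sigma>) ` {\<tau> \<in> X. \<sigma> \<subseteq> \<tau>}" by (auto simp: link_def)
  then show "finite (link X \<sigma>)" using X by (simp add: pure_simplicial_complex_def)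
  show "{} \<in> link X \<sigma>" using s by (simp add: in_link_iff[OF X])
  show "finite \<tau>" if "\<tau> \<in> link X \<sigma>" for \<tau>
    using that X by (auto simp: in_link_iff[OF X] pure_simplicial_complex_def)
  show "\<tau> \<in> link X \<sigma>" if "\<rho> \<in> link X \<sigma>" "\<tau> \<subseteq> \<rho>" for \<rho> \<tau>
  proof -
    have "\<sigma> \<union> \<tau> \<subseteq> \<sigma> \<union> \<rho>" using that by blast
    moreover have "\<sigma> \<union> \<rho> \<in> X" "\<rho> \<inter> \<sigma> = {}" using that by (simp_all add: in_link_iff[OF X])
    ultimately have "\<sigma> \<union> \<tau> \<in> X" using X unfolding pure_simplicial_complex_def by blast
    moreover have "\<tau> \<inter> \<sigma> = {}" using \<open>\<rho> \<inter> \<sigma> = {}\<close> that by blast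
    ultimately show ?thesis by (simp add: in_link_iff[OF X])
  qed
  show "int (card \<tau>) = d - int (card \<sigma>) + 1"
    if t: "\<tau> \<in> link X \<sigma>" and m: "\<forall>\<rho>\<in>link X \<sigma>. \<tau> \<subseteq> \<rho> \<longrightarrow> \<rho> = \<tau>" for \<tau>
  proof -
    have t': "\<tau> \<inter> \<sigma> = {}" "\<sigma> \<union> \<tau> \<in> X" using t by (auto simp: in_link_iff[OF X])
    have "\<forall>\<rho>\<in>X. \<sigma> \<union> \<tau> \<subseteq> \<rho> \<longrightarrow> \<rho> = \<sigma> \<union> \<tau>"
    proof (intro ballI impI)
      fix \<rho> assume r: "\<rho> \<in> X" "\<sigma> \<union> \<tau> \<subseteq> \<rho>"
      then have "\<rho> - \<sigma> \<in> link X \<sigma>" by (auto simp: link_def)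
      moreover have "\<tau> \<subseteq> \<rho> - \<sigma>" using r t' by blast
      ultimately have "\<rho> - \<sigma> = \<tau>" using m by blast
      with r show "\<rho> = \<sigma> \<union> \<tau>" by blast
    qed
    with t' X have "int (card (\<sigma> \<union> \<tau>)) = d + 1" unfolding pure_simplicial_complex_def by blast
    moreover have "card (\<sigma> \<union> \<tau>) = card \<sigma> + card \<tau>"
      using t' X fs by (intro card_Un_disjoint) (auto simp: pure_simplicial_complex_def)
    ultimately show ?thesis by simp
  qed
qed

lemma pmf_face_pmf:
  assumes X: "pure_simplicial_complex d X" and j: "-1 \<le> j" "j \<le> d"
  shows "pmf (face_pmf X j) \<tau> =
    (if \<tau> \<in> faces X j
     then card {\<rho> \<in> faces X d. \<tau> \<subseteq> \<rho>} / (card (faces X d) * (nat (d + 1) choose nat (j + 1)))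
     else 0)"
proof -
  let ?S = "\<lambda>\<rho>. {\<tau>. \<tau> \<subseteq> \<rho> \<and> int (card \<tau>) = j + 1}"
  let ?T = "faces X d"
  let ?c = "nat (d + 1) choose nat (j + 1)"
  have "{} \<in> X" using X by (simp add: pure_simplicial_complex_def)
  then have ne: "?T \<noteq> {}" using top_above[OF X] by blast
  have finT: "finite ?T" using X by (simp add: pure_simplicial_complex_def faces_def)
  have S: "finite (?S \<rho>)" "card (?S \<rho>) = ?c" "?S \<rho> \<noteq> {}" if "\<rho> \<in> ?T" for \<rho>
  proof -
    have f: "finite \<rho>" and c: "card \<rho> = nat (d + 1)"
      using that X by (auto simp: pure_simplicial_complex_def faces_def)
    show 1: "finite (?S \<rho>)" using f by simp
    have "?S \<rho> = {\<tau>. \<tau> \<subseteq> \<rho> \<and> card \<tau> = nat (j + 1)}" using j by auto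
    then show 2: "card (?S \<rho>) = ?c" using n_subsets[OF f, of "nat (j+1)"] c by simp
    have "?c > 0" using j by (intro zero_less_binomial) simp
    with 2 show "?S \<rho> \<noteq> {}" by (metis card.empty less_numeral_extra(3))
  qed
  have "pmf (face_pmf X j) \<tau> = (\<Sum>\<rho>\<in>?T. pmf (pmf_of_set (?S \<rho>)) \<tau>) / card ?T"
    unfolding face_pmf_def cdim_eq[OF X]
    by (subst pmf_bind) (simp add: integral_pmf_of_set[OF ne finT])
  also have "(\<Sum>\<rho>\<in>?T. pmf (pmf_of_set (?S \<rho>)) \<tau>) = (\<Sum>\<rho>\<in>?T. indicator (?S \<rho>) \<tau> / ?c)"
    by (intro sum.cong refl, subst pmf_of_set[OF S(3) S(1)]) (simp_all only: S(2))
  also have "\<dots> = (\<Sum>\<rho>\<in>?T. indicator (?S \<rho>) \<tau>) / ?c"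
    by (simp add: sum_divide_distrib)
  also have "(\<Sum>\<rho>\<in>?T. indicator (?S \<rho>) \<tau>) = (\<Sum>\<rho>\<in>?T. if \<tau> \<subseteq> \<rho> \<and> int (card \<tau>) = j + 1 then 1 else 0 :: real)"
    by (intro sum.cong refl) (simp add: indicator_def)
  also have "\<dots> = card {\<rho>\<in>?T. \<tau> \<subseteq> \<rho> \<and> int (card \<tau>) = j + 1}"
    using finT by (simp add: sum.If_cases Int_def)
  also have "{\<rho>\<in>?T. \<tau> \<subseteq> \<rho> \<and> int (card \<tau>) = j + 1} = (if \<tau> \<in> faces X j then {\<rho>\<in>?T. \<tau> \<subseteq> \<rho>} else {})"
    using X by (auto simp: faces_def pure_simplicial_complex_def)
  finally show ?thesis by (simp add: field_simps)
qed

lemma face_pmf_link: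
  assumes X: "pure_simplicial_complex d X" and s: "\<sigma> \<in> X"
    and j: "-1 \<le> j" "j \<le> d - int (card \<sigma>)"
  shows "face_pmf (link X \<sigma>) j =
    map_pmf (\<lambda>\<tau>. \<tau> - \<sigma>) (cond_pmf (face_pmf X (j + int (card \<sigma>))) {\<tau>. \<sigma> \<subseteq> \<tau>})"
proof -
  let ?L = "link X \<sigma>" and ?d = "d - int (card \<sigma>)" and ?i = "j + int (card \<sigma>)"
  let ?P = "face_pmf X ?i" and ?Q = "face_pmf (link X \<sigma>) j"
  let ?A = "{\<tau>. \<sigma> \<subseteq> \<tau>}"
  note L = pure_simplicial_complex_link[OF X s]
  have fX: "finite \<tau>" if "\<tau> \<in> X" for \<tau> using that X by (simp add: pure_simplicial_complex_def)
  have finX: "finite X" using X by (simp add: pure_simplicial_complex_def)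
  have mem: "\<sigma> \<union> \<tau> \<in> faces X (i + int (card \<sigma>))" if "\<tau> \<in> faces ?L i" for \<tau> i
  proof -
    have a: "\<tau> \<inter> \<sigma> = {}" "\<sigma> \<union> \<tau> \<in> X" "int (card \<tau>) = i + 1"
      using that by (auto simp: faces_def in_link_iff[OF X])
    then have "card (\<sigma> \<union> \<tau>) = card \<sigma> + card \<tau>"
      using fX[OF a(2)] by (intro card_Un_disjoint) auto
    with a show ?thesis by (simp add: faces_def)
  qed
  have mem': "\<tau> - \<sigma> \<in> faces ?L i" if "\<tau> \<in> faces X (i + int (card \<sigma>))" "\<sigma> \<subseteq> \<tau>" for \<tau> i
  proof -
    have "card \<sigma> \<le> card \<tau>" using that fX by (intro card_mono) (auto simp: faces_def)
    with that fX s show ?thesis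
      by (auto simp: faces_def in_link_iff[OF X] card_Diff_subset Un_absorb1)
  qed
  define p where "p = card (faces X d) * (nat (d + 1) choose nat (?i + 1))"
  define q where "q = card (faces ?L ?d) * (nat (?d + 1) choose nat (j + 1))"
  have Ppmf: "pmf ?P (\<sigma> \<union> \<tau>) = pmf ?Q \<tau> * (q / p)" if t: "\<tau> \<in> faces ?L j" for \<tau>
  proof -
    have dj: "\<tau> \<inter> \<sigma> = {}" using t by (simp add: faces_def in_link_iff[OF X])
    have "bij_betw (\<lambda>\<rho>. \<rho> - \<sigma>) {\<rho> \<in> faces X d. \<sigma> \<union> \<tau> \<subseteq> \<rho>} {\<rho> \<in> faces ?L ?d. \<tau> \<subseteq> \<rho>}"
    proof (rule bij_betw_byWitness[where f' = "\<lambda>\<rho>. \<sigma> \<union> \<rho>"])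
      show "\<forall>a\<in>{\<rho> \<in> faces X d. \<sigma> \<union> \<tau> \<subseteq> \<rho>}. \<sigma> \<union> (a - \<sigma>) = a" by blast
      show "\<forall>a'\<in>{\<rho> \<in> faces ?L ?d. \<tau> \<subseteq> \<rho>}. (\<sigma> \<union> a') - \<sigma> = a'"
        by (auto simp: faces_def in_link_iff[OF X])
      show "(\<lambda>\<rho>. \<rho> - \<sigma>) ` {\<rho> \<in> faces X d. \<sigma> \<union> \<tau> \<subseteq> \<rho>} \<subseteq> {\<rho> \<in> faces ?L ?d. \<tau> \<subseteq> \<rho>}"
        using mem'[of _ ?d] dj by auto
      show "(\<lambda>\<rho>. \<sigma> \<union> \<rho>) ` {\<rho> \<in> faces ?L ?d. \<tau> \<subseteq> \<rho>} \<subseteq> {\<rho> \<in> faces X d. \<sigma> \<union> \<tau> \<subseteq> \<rho>}"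
        using mem[of _ ?d] by auto
    qed
    then have c: "card {\<rho> \<in> faces X d. \<sigma> \<union> \<tau> \<subseteq> \<rho>} = card {\<rho> \<in> faces ?L ?d. \<tau> \<subseteq> \<rho>}"
      by (rule bij_betw_same_card)
    have "{} \<in> ?L" using L by (simp add: pure_simplicial_complex_def)
    then have "faces ?L ?d \<noteq> {}" using top_above[OF L] by blast
    moreover have "finite (faces ?L ?d)" using L by (simp add: pure_simplicial_complex_def faces_def)
    ultimately have q0: "q > 0" unfolding q_def using j by (auto simp: card_gt_0_iff)
    have "pmf ?Q \<tau> = card {\<rho> \<in> faces ?L ?d. \<tau> \<subseteq> \<rho>} / q"
      unfolding q_def using pmf_face_pmf[OF L j, of \<tau>] t by simp
    moreover have "pmf ?P (\<sigma> \<union> \<tau>) = card {\<rho> \<in> faces X d. \<sigma> \<union> \<tau> \<subseteq> \<rho>} / p"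
      unfolding p_def using pmf_face_pmf[OF X, of ?i "\<sigma> \<union> \<tau>"] mem[OF t] j by simp
    ultimately show ?thesis using c q0 by simp
  qed
  have supp: "set_pmf ?Q \<subseteq> faces ?L j"
    using pmf_face_pmf[OF L j] by (auto simp: set_pmf_iff split: if_splits)
  have suppP: "set_pmf ?P \<subseteq> faces X ?i"
    using pmf_face_pmf[OF X, of ?i] j by (auto simp: set_pmf_iff split: if_splits)
  have finQ: "finite (faces ?L j)" using L by (simp add: pure_simplicial_complex_def faces_def)
  have im: "(\<lambda>\<tau>. \<sigma> \<union> \<tau>) ` faces ?L j = faces X ?i \<inter> ?A"
  proof
    show "(\<lambda>\<tau>. \<sigma> \<union> \<tau>) ` faces ?L j \<subseteq> faces X ?i \<inter> ?A" using mem by auto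
    show "faces X ?i \<inter> ?A \<subseteq> (\<lambda>\<tau>. \<sigma> \<union> \<tau>) ` faces ?L j"
    proof
      fix \<tau> assume "\<tau> \<in> faces X ?i \<inter> ?A"
      with mem'[of \<tau> j] show "\<tau> \<in> (\<lambda>\<tau>. \<sigma> \<union> \<tau>) ` faces ?L j"
        by (intro image_eqI[of _ _ "\<tau> - \<sigma>"]) auto
    qed
  qed
  have inj: "inj_on (\<lambda>\<tau>. \<sigma> \<union> \<tau>) (faces ?L j)"
    by (rule inj_onI) (auto simp: faces_def in_link_iff[OF X])
  have "measure_pmf.prob ?P ?A = measure_pmf.prob ?P (faces X ?i \<inter> ?A)"
    using suppP by (intro measure_prob_cong_0) (auto simp: set_pmf_iff)
  also have "\<dots> = (\<Sum>\<tau>\<in>faces ?L j. pmf ?P (\<sigma> \<union> \<tau>))"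
    by (subst im[symmetric]) (simp add: measure_measure_pmf_finite finQ sum.reindex[OF inj])
  also have "\<dots> = (\<Sum>\<tau>\<in>faces ?L j. pmf ?Q \<tau>) * (q / p)"
    unfolding sum_distrib_right by (intro sum.cong refl Ppmf)
  also have "(\<Sum>\<tau>\<in>faces ?L j. pmf ?Q \<tau>) = 1"
    using sum_pmf_eq_1[OF finQ supp] .
  finally have prA: "measure_pmf.prob ?P ?A = q / p" by simp
  have p0: "p > 0"
  proof -
    from top_above[OF X s] have "faces X d \<noteq> {}" by blast
    moreover have "finite (faces X d)" using finX by (simp add: faces_def)
    ultimately show ?thesis unfolding p_def using j by (auto simp: card_gt_0_iff)
  qed
  have q0: "q > 0"
  proof -
    have "{} \<in> ?L" using L by (simp add: pure_simplicial_complex_def)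
    then have "faces ?L ?d \<noteq> {}" using top_above[OF L] by blast
    moreover have "finite (faces ?L ?d)" using L by (simp add: pure_simplicial_complex_def faces_def)
    ultimately show ?thesis unfolding q_def using j by (auto simp: card_gt_0_iff)
  qed
  from p0 q0 have qp: "q / p > (0::real)" by simp
  have Ane: "set_pmf ?P \<inter> ?A \<noteq> {}"
  proof
    assume "set_pmf ?P \<inter> ?A = {}"
    then have "?A \<inter> set_pmf ?P = {}" by blast
    then have "measure_pmf.prob ?P ?A = 0" using measure_Int_set_pmf[of ?P ?A] by simp
    with prA qp show False by linarith
  qed
  show ?thesis
  proof (rule pmf_eqI)
    fix \<tau>
    let ?C = "cond_pmf ?P ?A"
    have C: "pmf ?C \<rho> = (if \<rho> \<in> ?A then pmf ?P \<rho> / (q / p) else 0)" for \<rho>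
      by (simp add: pmf_cond[OF Ane] prA)
    have setC: "set_pmf ?C \<subseteq> faces X ?i \<inter> ?A" using suppP by (auto simp: set_cond_pmf[OF Ane])
    show "pmf ?Q \<tau> = pmf (map_pmf (\<lambda>\<tau>. \<tau> - \<sigma>) ?C) \<tau>"
    proof (cases "\<tau> \<in> faces ?L j")
      case True
      have dj: "\<tau> \<inter> \<sigma> = {}" using True by (simp add: faces_def in_link_iff[OF X])
      have "pmf (map_pmf (\<lambda>\<tau>. \<tau> - \<sigma>) ?C) \<tau> = measure_pmf.prob ?C ((\<lambda>\<tau>. \<tau> - \<sigma>) -` {\<tau>})"
        by (simp add: pmf_map)
      also have "\<dots> = measure_pmf.prob ?C {\<sigma> \<union> \<tau>}"
      proof (rule measure_prob_cong_0)
        fix x assume x: "x \<in> (\<lambda>\<tau>. \<tau> - \<sigma>) -` {\<tau>} - {\<sigma> \<union> \<tau>}"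
        have "\<not> \<sigma> \<subseteq> x" using x by auto
        then show "pmf ?C x = 0" by (simp add: C)
      next
        fix x assume "x \<in> {\<sigma> \<union> \<tau>} - (\<lambda>\<tau>. \<tau> - \<sigma>) -` {\<tau>}"
        then show "pmf ?C x = 0" using dj by auto
      qed
      also have "\<dots> = pmf ?Q \<tau>" using p0 q0 by (simp add: measure_pmf_single C Ppmf[OF True])
      finally show ?thesis by simp
    next
      case False
      then have "\<tau> \<notin> (\<lambda>\<tau>. \<tau> - \<sigma>) ` set_pmf ?C" using setC mem'[of _ j] by auto
      then have "pmf (map_pmf (\<lambda>\<tau>. \<tau> - \<sigma>) ?C) \<tau> = 0" by (simp add: pmf_eq_0_set_pmf)
      moreover have "pmf ?Q \<tau> = 0" using False supp by (auto simp: set_pmf_iff)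
      ultimately show ?thesis by simp
    qed
  qed
qed

end

theory Submission
  imports Defs
begin

text \<open>
  Fix a face \<open>\<sigma>\<close> of dimension \<open>l\<close>. Lifting a cochain \<open>h\<close> of the link to the cochain
  \<open>\<sigma> \<union> \<tau> \<mapsto> h \<tau>\<close> of \<open>X\<close> commutes with the coboundary, so minimality of \<open>f\<close> passes to
  \<open>f\<^sub>\<sigma>\<close>, and the norm of \<open>f\<^sub>\<sigma>\<close> is its distance from the coboundaries of the link.
  Evaluating \<open>\<delta> f = 0\<close> on \<open>\<sigma> \<union> \<tau>\<close> shows that \<open>\<delta> f\<^sub>\<sigma>\<close> is the sum of the
  cochains \<open>(f\<^sub>\<sigma>\<^sub>-\<^sub>u)\<^sup>u\<close> over \<open>u \<in> \<sigma>\<close>. Expansion of the link and the union bound give the claim.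
\<close>

text \<open>Extension by zero: adding a lift to a cochain of \<open>X\<close> changes it only on
  faces containing \<open>\<sigma>\<close>. The sole guard is
  \<open>\<sigma> \<subseteq> \<rho>\<close>; a lift vanishes off the faces of \<open>X\<close>
  because \<open>h\<close> vanishes off those of the link.\<close>

definition lift_cochain :: "'a set \<Rightarrow> ('a set \<Rightarrow> bit) \<Rightarrow> ('a set \<Rightarrow> bit)" where
  "lift_cochain \<sigma> h = (\<lambda>\<rho>. if \<sigma> \<subseteq> \<rho> then h (\<rho> - \<sigma>) else 0)"

section \<open>Faces, supports and norms in a link\<close>

lemma union_in_faces_iff:
  assumes X: "pure_simplicial_complex d X" and dj: "\<tau> \<inter> \<sigma> = {}"
  shows "\<sigma> \<union> \<tau> \<in> faces X (j + int (card \<sigma>)) \<longleftrightarrow> \<tau> \<in> faces (link X \<sigma>) j"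
proof (cases "\<sigma> \<union> \<tau> \<in> X")
  case True
  then have "finite (\<sigma> \<union> \<tau>)" using X by (simp add: pure_simplicial_complex_def)
  then have "card (\<sigma> \<union> \<tau>) = card \<sigma> + card \<tau>"
    using dj by (intro card_Un_disjoint) auto
  with True dj show ?thesis by (auto simp: faces_def in_link_iff[OF X])
qed (simp add: faces_def in_link_iff[OF X])

lemma faces_linkD:
  assumes "pure_simplicial_complex d X" and "\<tau> \<in> faces (link X \<sigma>) j"
  shows "\<tau> \<inter> \<sigma> = {}" and "\<sigma> \<union> \<tau> \<in> faces X (j + int (card \<sigma>))"
  using assms union_in_faces_iff[OF assms(1), of \<tau> \<sigma> j]
  by (auto simp: faces_def in_link_iff)

text \<open>By purity every face lies in some \<open>d\<close>-face, so every \<open>j\<close>-face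
  gets positive mass.\<close>

lemma set_face_pmf:
  assumes X: "pure_simplicial_complex d X" and j: "-1 \<le> j" "j \<le> d"
  shows "set_pmf (face_pmf X j) = faces X j"
proof -
  have "pmf (face_pmf X j) \<tau> \<noteq> 0" if t: "\<tau> \<in> faces X j" for \<tau>
  proof -
    have "\<tau> \<in> X" using t by (simp add: faces_def)
    from top_above[OF X this] obtain \<rho> where r: "\<rho> \<in> faces X d" "\<tau> \<subseteq> \<rho>" .
    have fin: "finite (faces X d)" using X by (simp add: pure_simplicial_complex_def faces_def)
    have "card {\<rho> \<in> faces X d. \<tau> \<subseteq> \<rho>} \<noteq> 0" "card (faces X d) \<noteq> 0"
      using r fin by auto
    then show ?thesis using t j by (simp add: pmf_face_pmf[OF X j])
  qed
  then show ?thesis by (auto simp: set_pmf_iff pmf_face_pmf[OF X j] split: if_splits)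
qed

text \<open>The link distribution is a conditional distribution on \<open>X\<close>. The denominator
  does not depend on \<open>g\<close>, so norms in the link can be compared through probabilities in
  \<open>X\<close>.\<close>

lemma cnorm_link:
  assumes X: "pure_simplicial_complex d X" and s: "\<sigma> \<in> X"
    and j: "-1 \<le> j" "j \<le> d - int (card \<sigma>)"
  defines "P \<equiv> face_pmf X (j + int (card \<sigma>))"
  shows "measure_pmf.prob P {\<tau>. \<sigma> \<subseteq> \<tau>} > 0"
    and "cnorm (link X \<sigma>) j g =
      measure_pmf.prob P {\<tau>. \<sigma> \<subseteq> \<tau> \<and> g (\<tau> - \<sigma>) \<noteq> 0} / measure_pmf.prob P {\<tau>. \<sigma> \<subseteq> \<tau>}"
proof -
  let ?A = "{\<tau>. \<sigma> \<subseteq> \<tau>}"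
  note L = pure_simplicial_complex_link[OF X s]
  \<comment> \<open>The support of a pmf is never empty, which supplies a \<open>j\<close>-face of
    the link.\<close>
  have "faces (link X \<sigma>) j \<noteq> {}"
    using set_face_pmf[OF L j] set_pmf_not_empty by metis
  then obtain \<tau> where "\<tau> \<in> faces (link X \<sigma>) j" by blast
  from faces_linkD(2)[OF X this] have "\<sigma> \<union> \<tau> \<in> set_pmf P"
    unfolding P_def using j by (subst set_face_pmf[OF X]) auto
  then have ne: "set_pmf P \<inter> ?A \<noteq> {}" by blast
  show "measure_pmf.prob P ?A > 0"
    by (rule measure_pmf_posI[of "\<sigma> \<union> \<tau>"]) (use \<open>\<sigma> \<union> \<tau> \<in> set_pmf P\<close> in auto)
  have "cnorm (link X \<sigma>) j g = measure_pmf.prob (cond_pmf P ?A) {\<tau>. g (\<tau> - \<sigma>) \<noteq> 0}"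
    by (simp add: cnorm_def face_pmf_link[OF X s j] P_def vimage_def)
  also have "\<dots> = measure_pmf.prob P {\<tau>. \<sigma> \<subseteq> \<tau> \<and> g (\<tau> - \<sigma>) \<noteq> 0} / measure_pmf.prob P ?A"
    using emeasure_measure_pmf_not_zero[OF ne]
    by (simp add: cond_pmf.rep_eq[OF ne] measure_uniform_measure Int_def)
  finally show "cnorm (link X \<sigma>) j g =
    measure_pmf.prob P {\<tau>. \<sigma> \<subseteq> \<tau> \<and> g (\<tau> - \<sigma>) \<noteq> 0} / measure_pmf.prob P ?A" .
qed

lemma cnorm_zero: "cnorm X j 0 = 0"
  by (simp add: cnorm_def)

section \<open>Lifting cochains from the link and transfer of minimality\<close>

lemma lift_cochain_in_cochains:
  assumes X: "pure_simplicial_complex d X" and h: "h \<in> cochains (link X \<sigma>) j"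
  shows "lift_cochain \<sigma> h \<in> cochains X (j + int (card \<sigma>))"
proof -
  have "\<rho> \<in> faces X (j + int (card \<sigma>))" if "lift_cochain \<sigma> h \<rho> \<noteq> 0" for \<rho>
  proof -
    from that have s: "\<sigma> \<subseteq> \<rho>" and "h (\<rho> - \<sigma>) \<noteq> 0"
      by (auto simp: lift_cochain_def split: if_splits)
    with h have "\<rho> - \<sigma> \<in> faces (link X \<sigma>) j" by (auto simp: cochains_def)
    from faces_linkD(2)[OF X this] s show ?thesis by (simp add: Un_absorb1)
  qed
  then show ?thesis unfolding cochains_def by blast
qed

text \<open>Removing a vertex of \<open>\<sigma>\<close> leaves a set that does not contain
  \<open>\<sigma>\<close>, where the lift is 0. Only vertices of \<open>\<rho> - \<sigma>\<close>
  contribute, and they give the coboundary in the link.\<close>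

lemma coboundary_lift_cochain:
  assumes X: "pure_simplicial_complex d X"
  shows "coboundary X (j + int (card \<sigma>)) (lift_cochain \<sigma> h) =
    lift_cochain \<sigma> (coboundary (link X \<sigma>) j h)"
proof
  fix \<rho>
  show "coboundary X (j + int (card \<sigma>)) (lift_cochain \<sigma> h) \<rho> =
    lift_cochain \<sigma> (coboundary (link X \<sigma>) j h) \<rho>"
  proof (cases "\<sigma> \<subseteq> \<rho> \<and> \<rho> \<in> faces X (j + int (card \<sigma>) + 1)")
    case True
    then have fin: "finite \<rho>" using X by (simp add: pure_simplicial_complex_def faces_def)
    have link: "\<rho> - \<sigma> \<in> faces (link X \<sigma>) (j + 1)"
      using True union_in_faces_iff[OF X, of "\<rho> - \<sigma>" \<sigma> "j + 1"]
      by (auto simp: Un_absorb1 algebra_simps)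
    have "(\<Sum>v\<in>\<rho>. lift_cochain \<sigma> h (\<rho> - {v})) = (\<Sum>v\<in>\<rho> - \<sigma>. lift_cochain \<sigma> h (\<rho> - {v}))"
      using fin True by (intro sum.mono_neutral_right) (auto simp: lift_cochain_def)
    also have "\<dots> = (\<Sum>v\<in>\<rho> - \<sigma>. h (\<rho> - \<sigma> - {v}))"
      using True by (intro sum.cong refl) (auto simp: lift_cochain_def intro!: arg_cong[of _ _ h])
    finally show ?thesis
      using True link by (simp add: coboundary_def) (simp add: lift_cochain_def)
  next
    case False
    then consider "\<not> \<sigma> \<subseteq> \<rho>" | "\<sigma> \<subseteq> \<rho>" "\<rho> \<notin> faces X (j + int (card \<sigma>) + 1)" by blast
    then show ?thesis
    proof cases
      case 1
      then have "\<not> \<sigma> \<subseteq> \<rho> - {v}" for v by blast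
      with 1 show ?thesis by (simp add: coboundary_def lift_cochain_def)
    next
      case 2
      then have "\<rho> - \<sigma> \<notin> faces (link X \<sigma>) (j + 1)"
        using union_in_faces_iff[OF X, of "\<rho> - \<sigma>" \<sigma> "j + 1"]
        by (auto simp: Un_absorb1 algebra_simps)
      with 2 show ?thesis by (simp add: coboundary_def lift_cochain_def)
    qed
  qed
qed

text \<open>The lift of a coboundary \<open>g\<close> of the link is a coboundary of
  \<open>X\<close>, so it competes with \<open>f\<close>. Since \<open>f\<close> and
  \<open>f + ?g\<close> agree on sets not containing \<open>\<sigma>\<close>, the inequality
  survives restriction to sets that contain it, and \<open>cnorm_link\<close> turns it into one
  between norms in the link.\<close>

lemma cnorm_localization_le:
  assumes X: "pure_simplicial_complex d X" and f: "minimal_cocycle X k f"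
    and s: "\<sigma> \<in> X" and k: "int (card \<sigma>) - 1 \<le> k" "k \<le> d"
    and g: "g \<in> coboundaries (link X \<sigma>) (k - int (card \<sigma>))"
  shows "cnorm (link X \<sigma>) (k - int (card \<sigma>)) (localization X k f \<sigma>)
    \<le> cnorm (link X \<sigma>) (k - int (card \<sigma>)) (localization X k f \<sigma> + g)"
proof -
  let ?j = "k - int (card \<sigma>)" and ?P = "face_pmf X k" and ?A = "{\<tau>. \<sigma> \<subseteq> \<tau>}"
  let ?g = "lift_cochain \<sigma> g"
  have j: "-1 \<le> ?j" "?j \<le> d - int (card \<sigma>)" using k by auto
  from g obtain h where h: "h \<in> cochains (link X \<sigma>) (?j - 1)" "g = coboundary (link X \<sigma>) (?j - 1) h"
    by (auto simp: coboundaries_def)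
  have dim: "?j - 1 + int (card \<sigma>) = k - 1" by simp
  have "?g \<in> coboundaries X k"
    unfolding coboundaries_def h(2) coboundary_lift_cochain[OF X, symmetric] dim
    using lift_cochain_in_cochains[OF X h(1), unfolded dim] by (rule imageI)
  with f have le: "cnorm X k f \<le> cnorm X k (f + ?g)" by (simp add: minimal_cocycle_def)
  have f0: "f \<rho> = 0" if "\<rho> \<notin> faces X k" for \<rho>
    using f that by (simp add: minimal_cocycle_def cocycles_def cochains_def)
  \<comment> \<open>Where the guard of \<open>localization\<close> fails, \<open>\<rho>\<close> is
    not a \<open>k\<close>-face and \<open>f\<close> vanishes as well.\<close>
  have loc: "localization X k f \<sigma> (\<rho> - \<sigma>) = f \<rho>" if "\<sigma> \<subseteq> \<rho>" for \<rho>
    using that f0[of \<rho>] union_in_faces_iff[OF X, of "\<rho> - \<sigma>" \<sigma> ?j]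
    by (auto simp: localization_def Un_absorb1)
  have split: "measure_pmf.prob ?P S =
      measure_pmf.prob ?P (S \<inter> ?A) + measure_pmf.prob ?P (S - ?A)" for S
    by (subst measure_pmf.finite_measure_Union[symmetric]) (auto intro: arg_cong[where f="measure_pmf.prob ?P"])
  have "{\<rho>. (f + ?g) \<rho> \<noteq> 0} - ?A = {\<rho>. f \<rho> \<noteq> 0} - ?A"
    by (auto simp: lift_cochain_def)
  with le have "measure_pmf.prob ?P ({\<rho>. f \<rho> \<noteq> 0} \<inter> ?A)
      \<le> measure_pmf.prob ?P ({\<rho>. (f + ?g) \<rho> \<noteq> 0} \<inter> ?A)"
    using split[of "{\<rho>. f \<rho> \<noteq> 0}"] split[of "{\<rho>. (f + ?g) \<rho> \<noteq> 0}"] by (simp add: cnorm_def)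
  also have "{\<rho>. f \<rho> \<noteq> 0} \<inter> ?A = {\<rho>. \<sigma> \<subseteq> \<rho> \<and> localization X k f \<sigma> (\<rho> - \<sigma>) \<noteq> 0}"
    by (auto simp: loc)
  also have "{\<rho>. (f + ?g) \<rho> \<noteq> 0} \<inter> ?A
      = {\<rho>. \<sigma> \<subseteq> \<rho> \<and> (localization X k f \<sigma> + g) (\<rho> - \<sigma>) \<noteq> 0}"
    by (auto simp: loc lift_cochain_def)
  finally show ?thesis
    using cnorm_link(1)[OF X s j] by (simp add: cnorm_link(2)[OF X s j] divide_right_mono)
qed

section \<open>The coboundary of the localization\<close>

lemma bit_add_eq_0_iff: "a + b = 0 \<longleftrightarrow> a = b" for a b :: bit
  by (cases a; cases b) simp_all

text \<open>The terms of \<open>coboundary X k f (\<sigma> \<union> \<tau>)\<close> that remove a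
  vertex of \<open>\<tau>\<close> form the left-hand side; those that remove a vertex of
  \<open>\<sigma>\<close> form the right-hand side. Their total is 0, so in characteristic 2 they
  agree.\<close>

lemma coboundary_localization:
  assumes X: "pure_simplicial_complex d X" and f: "f \<in> cocycles X k"
    and t: "\<tau> \<in> faces (link X \<sigma>) (k - int (card \<sigma>) + 1)"
  shows "coboundary (link X \<sigma>) (k - int (card \<sigma>)) (localization X k f \<sigma>) \<tau>
    = (\<Sum>u\<in>\<sigma>. f (\<sigma> - {u} \<union> \<tau>))"
proof -
  let ?j = "k - int (card \<sigma>)"
  have dj: "\<tau> \<inter> \<sigma> = {}" and face: "\<sigma> \<union> \<tau> \<in> faces X (k + 1)"
    using faces_linkD[OF X t] by (simp_all add: algebra_simps)
  have fin: "finite \<sigma>" "finite \<tau>"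
    using face X by (auto simp: pure_simplicial_complex_def faces_def)
  have f0: "f \<rho> = 0" if "\<rho> \<notin> faces X k" for \<rho>
    using f that by (simp add: cocycles_def cochains_def)
  have "0 = coboundary X k f (\<sigma> \<union> \<tau>)" using f by (simp add: cocycles_def)
  also have "\<dots> = (\<Sum>u\<in>\<sigma>. f (\<sigma> \<union> \<tau> - {u})) + (\<Sum>v\<in>\<tau>. f (\<sigma> \<union> \<tau> - {v}))"
    using face fin dj by (simp add: coboundary_def sum.union_disjoint Int_commute)
  also have "(\<Sum>u\<in>\<sigma>. f (\<sigma> \<union> \<tau> - {u})) = (\<Sum>u\<in>\<sigma>. f (\<sigma> - {u} \<union> \<tau>))"
    using dj by (intro sum.cong refl arg_cong[of _ _ f]) blast
  also have "(\<Sum>v\<in>\<tau>. f (\<sigma> \<union> \<tau> - {v})) = (\<Sum>v\<in>\<tau>. localization X k f \<sigma> (\<tau> - {v}))"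
  proof (intro sum.cong refl)
    fix v assume v: "v \<in> \<tau>"
    have eq: "\<sigma> \<union> \<tau> - {v} = \<sigma> \<union> (\<tau> - {v})" using v dj by blast
    show "f (\<sigma> \<union> \<tau> - {v}) = localization X k f \<sigma> (\<tau> - {v})"
      using union_in_faces_iff[OF X, of "\<tau> - {v}" \<sigma> ?j] dj f0[of "\<sigma> \<union> (\<tau> - {v})"]
      unfolding eq localization_def by auto
  qed
  also have "\<dots> = coboundary (link X \<sigma>) ?j (localization X k f \<sigma>) \<tau>"
    using t by (simp add: coboundary_def)
  finally show ?thesis by (metis bit_add_eq_0_iff)
qed

text \<open>Unfolds the two nested guards: a face of the link of \<open>\<sigma>\<close> is a face
  of the link of \<open>\<sigma> - {u}\<close>, and also of the link of \<open>u\<close> inside the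
  latter.\<close>

lemma restriction_localization:
  assumes X: "pure_simplicial_complex d X" and s: "\<sigma> \<in> X" and u: "u \<in> \<sigma>"
    and t: "\<tau> \<in> faces (link X \<sigma>) (k - int (card \<sigma>) + 1)"
  shows "restriction (link X (\<sigma> - {u})) (k - int (card \<sigma>) + 1)
      (localization X k f (\<sigma> - {u})) {u} \<tau> = f (\<sigma> - {u} \<union> \<tau>)"
proof -
  let ?L = "link X (\<sigma> - {u})"
  have closed: "\<rho> \<in> X" if "\<rho> \<subseteq> \<rho>'" "\<rho>' \<in> X" for \<rho> \<rho>'
    using that X unfolding pure_simplicial_complex_def by blast
  have fs: "finite \<sigma>" using s X by (simp add: pure_simplicial_complex_def)
  have s': "\<sigma> - {u} \<in> X" using s by (rule closed[rotated]) blast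
  have "card (\<sigma> - {u}) + 1 = card \<sigma>" using fs u by (metis Suc_eq_plus1 card_Suc_Diff1)
  \<comment> \<open>One vertex fewer in the face raises the dimension of the localization by one, to
    that of the restriction.\<close>
  then have c: "k - int (card (\<sigma> - {u})) = k - int (card \<sigma>) + 1" by linarith
  note L = pure_simplicial_complex_link[OF X s']
  have dj: "\<tau> \<inter> \<sigma> = {}" and x: "\<sigma> \<union> \<tau> \<in> X"
    using t by (auto simp: faces_def in_link_iff[OF X])
  have "\<sigma> - {u} \<union> \<tau> \<in> X" using x by (rule closed[rotated]) blast
  then have 1: "\<tau> \<in> faces ?L (k - int (card \<sigma>) + 1)"
    using t dj by (auto simp: faces_def in_link_iff[OF X])
  have "\<sigma> - {u} \<union> ({u} \<union> \<tau>) = \<sigma> \<union> \<tau>" using u by blast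
  then have "{u} \<union> \<tau> \<in> ?L" using dj x by (auto simp: in_link_iff[OF X])
  then have 2: "\<tau> \<in> faces (link ?L {u}) (k - int (card \<sigma>) + 1)"
    using t dj u by (auto simp: faces_def in_link_iff[OF L])
  show ?thesis using 1 2 by (simp add: restriction_def localization_def c)
qed

text \<open>A union bound over \<open>u\<close>: a sum is nonzero only if one of its terms
  is.\<close>

lemma cnorm_coboundary_localization_le:
  assumes X: "pure_simplicial_complex d X" and f: "f \<in> cocycles X k" and s: "\<sigma> \<in> X"
    and k: "int (card \<sigma>) - 1 \<le> k" "k < d"
  shows "cnorm (link X \<sigma>) (k - int (card \<sigma>) + 1)
      (coboundary (link X \<sigma>) (k - int (card \<sigma>)) (localization X k f \<sigma>))
    \<le> (\<Sum>u\<in>\<sigma>. cnorm (link X \<sigma>) (k - int (card \<sigma>) + 1)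
        (restriction (link X (\<sigma> - {u})) (k - int (card \<sigma>) + 1)
          (localization X k f (\<sigma> - {u})) {u}))"
proof -
  let ?j = "k - int (card \<sigma>)"
  let ?P = "face_pmf (link X \<sigma>) (?j + 1)"
  let ?D = "coboundary (link X \<sigma>) ?j (localization X k f \<sigma>)"
  let ?r = "\<lambda>u. restriction (link X (\<sigma> - {u})) (?j + 1) (localization X k f (\<sigma> - {u})) {u}"
  have fs: "finite \<sigma>" using s X by (simp add: pure_simplicial_complex_def)
  have supp: "set_pmf ?P = faces (link X \<sigma>) (?j + 1)"
    \<comment> \<open>\<open>k < d\<close> keeps \<open>?j + 1\<close> within the dimension of the
      link.\<close>
    using k by (intro set_face_pmf[OF pure_simplicial_complex_link[OF X s]]) auto
  \<comment> \<open>The formula for \<open>?D\<close> is available only on faces of the link, hence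
    the intersection with the support.\<close>
  have sub: "{\<tau>. ?D \<tau> \<noteq> 0} \<inter> set_pmf ?P \<subseteq> (\<Union>u\<in>\<sigma>. {\<tau>. ?r u \<tau> \<noteq> 0})"
  proof
    fix \<tau> assume "\<tau> \<in> {\<tau>. ?D \<tau> \<noteq> 0} \<inter> set_pmf ?P"
    then have t: "\<tau> \<in> faces (link X \<sigma>) (?j + 1)" and "?D \<tau> \<noteq> 0" using supp by auto
    then have "(\<Sum>u\<in>\<sigma>. ?r u \<tau>) \<noteq> 0"
      using coboundary_localization[OF X f t] restriction_localization[OF X s _ t, of _ f] by simp
    then obtain u where "u \<in> \<sigma>" "?r u \<tau> \<noteq> 0" by (rule sum.not_neutral_contains_not_neutral)
    then show "\<tau> \<in> (\<Union>u\<in>\<sigma>. {\<tau>. ?r u \<tau> \<noteq> 0})" by blast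
  qed
  have "cnorm (link X \<sigma>) (?j + 1) ?D = measure_pmf.prob ?P ({\<tau>. ?D \<tau> \<noteq> 0} \<inter> set_pmf ?P)"
    by (simp add: cnorm_def measure_Int_set_pmf)
  also have "\<dots> \<le> measure_pmf.prob ?P (\<Union>u\<in>\<sigma>. {\<tau>. ?r u \<tau> \<noteq> 0})"
    using sub by (intro measure_pmf.finite_measure_mono) auto
  also have "\<dots> \<le> (\<Sum>u\<in>\<sigma>. measure_pmf.prob ?P {\<tau>. ?r u \<tau> \<noteq> 0})"
    using fs by (intro measure_pmf.finite_measure_subadditive_finite) auto
  finally show ?thesis by (simp add: cnorm_def)
qed

section \<open>Combining minimality, expansion and the union bound\<close>

lemma localization_in_cochains:
  "localization X k f \<sigma> \<in> cochains (link X \<sigma>) (k - int (card \<sigma>))"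
  by (simp add: localization_def cochains_def)

theorem theorem5p1:
  fixes X :: "'a set set" and d k l :: int and \<beta> :: real and f :: "'a set \<Rightarrow> bit"
  assumes "pure_simplicial_complex d X"
    and "\<beta> > 0"
    and "\<And>\<sigma>. \<sigma> \<in> X \<Longrightarrow> \<sigma> \<noteq> {} \<Longrightarrow> int (card \<sigma>) - 1 \<le> d - 2 \<Longrightarrow> coboundary_expander \<beta> (link X \<sigma>)"
    and "0 \<le> l" and "l < k" and "k < d"
    and "minimal_cocycle X k f"
  shows "double_balanced ((real_of_int l + 1) / \<beta>) l X k f"
  unfolding double_balanced_def
proof
  fix \<sigma> assume face: "\<sigma> \<in> faces X l"
  let ?L = "link X \<sigma>" and ?loc = "localization X k f \<sigma>"
  let ?n = "\<lambda>u. cnorm ?L (k - l)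
    (restriction (link X (\<sigma> - {u})) (k - l) (localization X k f (\<sigma> - {u})) {u})"
  let ?B = "coboundaries ?L (k - l - 1)"
  note X = assms(1)
  have s: "\<sigma> \<in> X" and c: "int (card \<sigma>) = l + 1" using face by (auto simp: faces_def)
  have ne: "\<sigma> \<noteq> {}" and fs: "finite \<sigma>" using c \<open>0 \<le> l\<close> by (auto intro: card_ge_0_finite)
  have j: "k - int (card \<sigma>) = k - l - 1" "k - int (card \<sigma>) + 1 = k - l" using c by auto
  \<comment> \<open>The factor \<open>l + 1\<close> is the number of vertices of
    \<open>\<sigma>\<close>: it turns the average over \<open>u\<close> into the sum from the union
    bound.\<close>
  have "real (card \<sigma>) = real_of_int l + 1" using c by (metis of_int_1 of_int_add of_int_of_nat_eq)
  then have E: "(real_of_int l + 1) * measure_pmf.expectation (pmf_of_set \<sigma>) ?n = sum ?n \<sigma>"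
    using ne fs \<open>0 \<le> l\<close> by (simp add: integral_pmf_of_set)
  have f: "f \<in> cocycles X k" using assms(7) by (simp add: minimal_cocycle_def)
  have min: "cnorm ?L (k - l - 1) ?loc \<le> cnorm ?L (k - l - 1) (?loc + g)" if "g \<in> ?B" for g
    using cnorm_localization_le[OF X assms(7) s, unfolded j, of g] that assms(4-6) c by simp
  have cob: "cnorm ?L (k - l) (coboundary ?L (k - l - 1) ?loc) \<le> sum ?n \<sigma>"
    using cnorm_coboundary_localization_le[OF X f s, unfolded j] assms(4-6) c by simp
  have "\<beta> * cnorm ?L (k - l - 1) ?loc \<le> sum ?n \<sigma>"
  proof (cases "?loc \<in> ?B")
    case True
    \<comment> \<open>Expansion speaks only of cochains that are not coboundaries. Here
      \<open>?loc\<close> may be added to itself, so minimality forces its norm to be 0.\<close>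
    have "?loc + ?loc = 0" by (simp add: fun_eq_iff)
    with min[OF True] have "cnorm ?L (k - l - 1) ?loc \<le> 0" by (simp add: cnorm_zero)
    then have "\<beta> * cnorm ?L (k - l - 1) ?loc \<le> 0"
      using \<open>\<beta> > 0\<close> by (simp add: mult_nonneg_nonpos)
    also have "0 \<le> sum ?n \<sigma>" by (simp add: cnorm_def sum_nonneg)
    finally show ?thesis .
  next
    case False
    \<comment> \<open>A lower bound on the infimum in \<open>cdist_set\<close> requires a nonempty
      set of coboundaries.\<close>
    have "0 \<in> cochains ?L (k - l - 1 - 1)" by (simp add: cochains_def)
    then have Bne: "?B \<noteq> {}" by (auto simp: coboundaries_def)
    have minus: "?loc - g = ?loc + g" for g by (simp add: fun_eq_iff)
    have "cnorm ?L (k - l - 1) ?loc \<le> cdist_set ?L (k - l - 1) ?loc ?B"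
      unfolding cdist_set_def using min Bne by (intro cINF_greatest) (simp_all add: minus)
    then have "\<beta> * cnorm ?L (k - l - 1) ?loc \<le> \<beta> * cdist_set ?L (k - l - 1) ?loc ?B"
      using \<open>\<beta> > 0\<close> by simp
    also have "\<dots> \<le> cnorm ?L (k - l) (coboundary ?L (k - l - 1) ?loc)"
    proof -
      \<comment> \<open>From \<open>l < k < d\<close> the dimension \<open>l\<close> of
        \<open>\<sigma>\<close> is at most \<open>d - 2\<close>. The same bounds give
        \<open>0 \<le> k - l - 1 < d - l - 1\<close>, the range in which expansion applies.\<close>
      have "coboundary_expander \<beta> ?L" using assms(5,6) c ne by (intro assms(3) s) auto
      moreover have "cdim ?L = d - l - 1"
        using cdim_eq[OF pure_simplicial_complex_link[OF X s]] c by simp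
      moreover have "?loc \<in> cochains ?L (k - l - 1)"
        using localization_in_cochains[of X k f \<sigma>] by (simp add: j)
      ultimately show ?thesis
        using False assms(5,6) unfolding coboundary_expander_def
        by (auto dest!: spec[of _ "k - l - 1"])
    qed
    also note cob
    finally show ?thesis .
  qed
  then show "cnorm ?L (k - l - 1) ?loc
      \<le> (real_of_int l + 1) / \<beta> * measure_pmf.expectation (pmf_of_set \<sigma>) ?n"
    using E \<open>\<beta> > 0\<close> by (simp add: field_simps)
qed

end
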